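(* Let $p>0$ and let $(a_j)_{j\ge 1}$ be a sequence of positive real numbers with $\lim_{n\to\infty} a_n/a_{n+1}=1$ and $a_j\asymp j^{p-1}$ as $j\to\infty$. For each $n\ge 1$ let $\sigma_n$ be the unique real solution of $\sum_{l=1}^n l a_l e^{-l\sigma_n}=n$, let $Y=Y_n=X_1+\dots+X_n$, where $X_1,\dots,X_n$ are independent random variables with $\Pr(X_l=lk)=\frac{a_l^k e^{-\sigma_n lk}}{k!\,\exp(a_l e^{-\sigma_n l})}$ for $k=0,1,2,\dots$, let $\varphi(\alpha)=E\,e^{2\pi i\alpha Y_n}$, and let $B_n^2=\sum_{l=1}^n l^2a_le^{-l\sigma_n}$. Then $$\int_0^1\varphi(\alpha)e^{-2\pi i\alpha n}\,d\alpha=\Pr(Y_n=n)\sim\frac{1}{\sqrt{2\pi B_n^2}}\quad\text{as } n\to\infty .$$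
   Context: $a_j\asymp j^{p-1}$ as $j\to\infty$ means that there are constants $\gamma_1,\gamma_2>0$ with $\gamma_1 j^{p-1}\le a_j\le\gamma_2 j^{p-1}$ for all sufficiently large $j$. $f(n)\sim g(n)$ means $f(n)/g(n)\to1$. The random variable $X_l$ takes values in $\{0,l,2l,\dots\}$, and $X_l/l$ is Poisson with mean $a_le^{-\sigma_n l}$; its law depends on $n$ through $\sigma_n$, so the $X_l$ form a triangular array. *)

theory Defs
  imports "HOL-Probability.Probability" "HOL-Library.Landau_Symbols"
begin

definition tilt :: "(nat \<Rightarrow> real) \<Rightarrow> nat \<Rightarrow> real" where
  "tilt a n = (THE s. (\<Sum>l=1..n. real l * a l * exp (- (real l * s))) = real n)"

text \<open>The description above denotes: the left-hand side decreases strictly from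
  \<open>\<infinity>\<close> to \<open>0\<close>. For \<open>n = 0\<close> the value is arbitrary.\<close>

lemma tilt_ex1:
  fixes a :: "nat \<Rightarrow> real"
  assumes pos: "\<And>j. j \<ge> 1 \<Longrightarrow> a j > 0" and n: "n \<ge> 1"
  shows "\<exists>!s. (\<Sum>l=1..n. real l * a l * exp (- (real l * s))) = real n"
proof -
  define F where "F s = (\<Sum>l=1..n. real l * a l * exp (- (real l * s)))" for s
  have dec: "F t < F s" if "s < t" for s t
    unfolding F_def by (rule sum_strict_mono) (use pos n that in auto)
  have cont: "isCont F s" for s
    unfolding F_def by (intro continuous_intros)
  have "(F \<longlongrightarrow> (\<Sum>l=1..n. real l * a l * 0)) at_top"
    unfolding F_def
  proof (intro tendsto_sum tendsto_mult tendsto_const)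
    fix l assume "l \<in> {1..n}"
    then have "filterlim (\<lambda>s. real l * s) at_top at_top"
      by (intro filterlim_tendsto_pos_mult_at_top[OF tendsto_const] filterlim_ident) auto
    then have "filterlim (\<lambda>s. - (real l * s)) at_bot at_top"
      by (simp add: filterlim_uminus_at_bot)
    then show "((\<lambda>s. exp (- (real l * s))) \<longlongrightarrow> 0) at_top"
      by (rule filterlim_compose[OF exp_at_bot])
  qed
  then have "eventually (\<lambda>s. F s < real n) at_top"
    using n by (auto intro!: order_tendstoD)
  then obtain t where t: "F t < real n"
    using eventually_happens trivial_limit_at_top_linorder by blast
  define u where "u = - ln (real n / a 1)"
  have "real n = real 1 * a 1 * exp (- (real 1 * u))"
    using pos[of 1] n by (simp add: u_def)
  also have "\<dots> \<le> F u"
    unfolding F_def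
    by (rule member_le_sum[of 1 "{1..n}" "\<lambda>l. real l * a l * exp (- (real l * u))"])
      (use pos n in \<open>auto intro!: mult_nonneg_nonneg less_imp_le\<close>)
  finally have u: "real n \<le> F u" .
  have "u \<le> t" using dec[of t u] t u by linarith
  then obtain s where "F s = real n"
    using IVT2[of F t "real n" u] t u cont by auto
  moreover have "s' = s" if "F s' = real n" "F s = real n" for s s'
    using dec[of s s'] dec[of s' s] that by (cases s s' rule: linorder_cases) auto
  ultimately show ?thesis unfolding F_def by blast
qed

definition Bsq :: "(nat \<Rightarrow> real) \<Rightarrow> nat \<Rightarrow> real" where
  "Bsq a n = (\<Sum>l=1..n. (real l)\<^sup>2 * a l * exp (- (real l * tilt a n)))"

text \<open>Here \<open>\<alpha>\<close> counts full periods, so this is the value at \<open>2 \<pi> \<alpha>\<close> of the usual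
  characteristic function of \<open>Y\<close>.\<close>

definition char_fn :: "'a measure \<Rightarrow> ('a \<Rightarrow> nat) \<Rightarrow> real \<Rightarrow> complex" where
  "char_fn M Y \<alpha> =
     (CLINT \<omega>|M. exp (2 * complex_of_real pi * \<i> * complex_of_real \<alpha> * of_nat (Y \<omega>)))"

end

theory Submission
  imports Defs "HOL-Real_Asymp.Real_Asymp"
begin

text \<open>
  The parameter \<open>\<sigma>\<close> is chosen so that \<open>Y\<close> has mean \<open>n\<close>, which makes \<open>n\<close> a saddle point: after the
  substitution \<open>\<alpha> = t / (2 \<pi> B)\<close> the inversion integral has integrand \<open>exp (\<Phi> t)\<close> with
  \<open>\<Phi> t = - t\<^sup>2 / 2 + O(\<bar>t\<bar>\<^sup>3 T / B\<^sup>3)\<close>, where \<open>T\<close> is the third cumulant. As \<open>a\<^sub>l\<close> is of order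
  \<open>l powr (p - 1)\<close>, one has \<open>\<sigma> \<longlonglongrightarrow> 0\<close> and \<open>n \<sigma> \<ge> 3\<close> eventually, \<open>B\<^sup>2\<close> is of order \<open>\<sigma> powr - (p + 2)\<close>
  and \<open>T\<close> is at most of order \<open>\<sigma> powr - (p + 3)\<close>, so the error term is \<open>O(\<sigma> powr (p / 2))\<close>.
  The limit is taken under the integral by dominated convergence with majorant \<open>C / (1 + t\<^sup>2)\<close>. For
  \<open>\<bar>\<alpha>\<bar> \<le> 1 / (2 N)\<close>, \<open>N = \<lfloor>1 / \<sigma>\<rfloor>\<close>, it comes from \<open>1 - cos (2 \<pi> \<alpha> l) \<ge> 8 \<alpha>\<^sup>2 l\<^sup>2\<close> for \<open>l \<le> N\<close>; for larger
  \<open>\<alpha>\<close> the sum of \<open>cos (2 \<pi> \<alpha> l)\<close> over \<open>N < l \<le> 3 N\<close> is at most \<open>N\<close>, which gives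
  \<open>\<bar>\<phi>(\<alpha>)\<bar> \<le> exp (- c \<sigma> powr - p)\<close>, smaller than every power of \<open>\<sigma>\<close>.
\<close>

section \<open>Trigonometric and power sums\<close>

text \<open>Jordan's inequality: sine is concave on \<open>{0..pi}\<close>, so it lies above its
  chord from 0 to \<open>pi / 2\<close>; the chord parameter is \<open>2 * z\<close>.\<close>

lemma sin_pi_ge_double:
  fixes z :: real
  assumes "0 \<le> z" "z \<le> 1 / 2"
  shows "2 * z \<le> sin (pi * z)"
proof -
  have "convex_on {0..pi} (\<lambda>x. - sin x)"
    by (rule f''_ge0_imp_convex[where f' = "\<lambda>x. - cos x" and f'' = sin])
      (auto intro!: derivative_eq_intros sin_ge_zero)
  from convex_onD[OF this, of "2 * z" 0 "pi / 2"] assms show ?thesis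
    by (simp add: mult.commute)
qed

lemma sin_pi_sq_ge:
  fixes z :: real
  assumes "\<bar>z\<bar> \<le> 1 / 2"
  shows "4 * z\<^sup>2 \<le> (sin (pi * z))\<^sup>2"
proof -
  have "(2 * \<bar>z\<bar>)\<^sup>2 \<le> (sin (pi * \<bar>z\<bar>))\<^sup>2"
    using sin_pi_ge_double[of "\<bar>z\<bar>"] assms by (intro power_mono) auto
  then show ?thesis
    by (simp add: power_mult_distrib abs_if split: if_splits)
qed

lemma one_minus_cos_ge:
  fixes z :: real
  assumes "\<bar>z\<bar> \<le> 1 / 2"
  shows "8 * z\<^sup>2 \<le> 1 - cos (2 * pi * z)"
  using sin_pi_sq_ge[OF assms] cos_double_sin[of "pi * z"] by (simp add: mult.assoc)

text \<open>Product-to-sum formula: \<open>2 * sin y * cos x\<close> is a difference of sines at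
  \<open>x + y\<close> and \<open>x - y\<close>. With \<open>y = pi * z\<close> consecutive terms
  share an endpoint, so the sum telescopes.\<close>

lemma sum_cos_telescope:
  fixes z :: real
  shows "2 * sin (pi * z) * (\<Sum>l=m+1..m+k. cos (2 * pi * z * real l)) =
    sin (pi * z * (2 * real (m + k) + 1)) - sin (pi * z * (2 * real m + 1))"
proof (induction k)
  case (Suc k)
  define x where "x = 2 * pi * z * real (Suc (m + k))"
  define y where "y = pi * z"
  have "sin (x + y) - sin (x - y) = 2 * sin y * cos x"
    by (simp add: sin_add sin_diff)
  moreover have "x + y = pi * z * (2 * real (m + Suc k) + 1)" "x - y = pi * z * (2 * real (m + k) + 1)"
    by (auto simp: x_def y_def algebra_simps)
  moreover have "(\<Sum>l=m+1..m+Suc k. cos (2 * pi * z * real l)) =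
     (\<Sum>l=m+1..m+k. cos (2 * pi * z * real l)) + cos x"
    by (simp add: x_def)
  ultimately show ?case
    using Suc.IH by (simp add: algebra_simps y_def)
qed simp

text \<open>The telescoped sum is at most 2, while the factor
  \<open>2 * sin (pi * \<bar>z\<bar>)\<close> is at least \<open>4 * \<bar>z\<bar>\<close>. The
  bound depends neither on the start nor on the length of the block.\<close>

lemma sum_cos_le:
  fixes z :: real
  assumes "z \<noteq> 0" "\<bar>z\<bar> \<le> 1 / 2"
  shows "(\<Sum>l=m+1..m+k. cos (2 * pi * z * real l)) \<le> 1 / (2 * \<bar>z\<bar>)"
proof -
  define S where "S = (\<Sum>l=m+1..m+k. cos (2 * pi * \<bar>z\<bar> * real l))"
  have eq: "S = (\<Sum>l=m+1..m+k. cos (2 * pi * z * real l))"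
    unfolding S_def by (intro sum.cong refl) (auto simp: abs_if)
  have s: "2 * \<bar>z\<bar> \<le> sin (pi * \<bar>z\<bar>)"
    using assms by (intro sin_pi_ge_double) auto
  have "2 * sin (pi * \<bar>z\<bar>) * S \<le> 2"
    using sum_cos_telescope[of "\<bar>z\<bar>" m k, folded S_def]
      sin_le_one[of "pi * \<bar>z\<bar> * (2 * real (m + k) + 1)"]
      sin_ge_minus_one[of "pi * \<bar>z\<bar> * (2 * real m + 1)"] by linarith
  \<comment> \<open>Replacing the sine by its lower bound needs a nonnegative sum; a negative sum
    satisfies the claim trivially.\<close>
  moreover have "2 * \<bar>z\<bar> * S \<le> sin (pi * \<bar>z\<bar>) * S" if "S \<ge> 0"
    using s that by (intro mult_right_mono) auto
  ultimately have "2 * \<bar>z\<bar> * S \<le> 1" if "S \<ge> 0" using that by simp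
  moreover have "2 * \<bar>z\<bar> * S \<le> 0" if "S < 0"
    using that by (simp add: mult_nonneg_nonpos)
  ultimately have "2 * \<bar>z\<bar> * S \<le> 1" by linarith
  then have "S \<le> 1 / (2 * \<bar>z\<bar>)"
    using assms by (simp add: field_simps)
  then show ?thesis by (simp add: eq)
qed

text \<open>This is \<open>ln u \<le> u - 1\<close> at \<open>u = c * x / m\<close>, multiplied by
  \<open>m\<close> and exponentiated. Dropping the \<open>- 1\<close> costs only a factor
  \<open>exp m\<close>.\<close>

lemma powr_le_exp:
  fixes c m x :: real
  assumes "c > 0" "m > 0" "x > 0"
  shows "x powr m \<le> (m / c) powr m * exp (c * x)"
proof -
  have "ln (c * x / m) \<le> c * x / m - 1"
    using assms by (intro ln_le_minus_one) auto
  then have "ln x \<le> ln (m / c) + c * x / m"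
    using assms by (simp add: ln_mult ln_div)
  then have "m * ln x \<le> m * (ln (m / c) + c * x / m)"
    using assms by (intro mult_left_mono) auto
  also have "\<dots> = m * ln (m / c) + c * x"
    using assms by (simp add: algebra_simps)
  finally have "exp (m * ln x) \<le> exp (m * ln (m / c)) * exp (c * x)"
    by (simp flip: exp_add)
  then show ?thesis
    using assms by (simp add: powr_def)
qed

text \<open>Half of the exponential absorbs the power, by \<open>powr_le_exp\<close> with
  \<open>c = 1/2\<close>. The other half leaves a geometric series of sum at most
  \<open>2 / s\<close>, whence a bound uniform in \<open>n\<close>.\<close>

lemma sum_powr_exp_le:
  fixes q s :: real
  assumes q: "q > 1" and s: "s > 0"
  shows "(\<Sum>l=1..n. real l powr (q - 1) * exp (- (real l * s))) \<le>
           2 * (2 * (q - 1)) powr (q - 1) * s powr - q"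
proof -
  let ?C = "(2 * (q - 1)) powr (q - 1)"
  have term_le: "real l powr (q - 1) * exp (- (real l * s)) \<le>
      ?C * s powr (1 - q) * exp (- s / 2) ^ l" if "l \<in> {1..n}" for l
  proof -
    have "(real l * s) powr (q - 1) \<le> ?C * exp (1 / 2 * (real l * s))"
      using powr_le_exp[of "1/2" "q - 1" "real l * s"] q s that by (simp add: mult.commute)
    then have "s powr (1 - q) * (real l * s) powr (q - 1) \<le>
        s powr (1 - q) * (?C * exp (1 / 2 * (real l * s)))"
      by (rule mult_left_mono) simp
    moreover have "s powr (1 - q) * (real l * s) powr (q - 1) = real l powr (q - 1)"
      using s by (simp add: powr_mult flip: powr_add)
    ultimately have "real l powr (q - 1) \<le> ?C * s powr (1 - q) * exp (real l * s / 2)"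
      by (simp add: ac_simps)
    then have "real l powr (q - 1) * exp (- (real l * s)) \<le>
       ?C * s powr (1 - q) * exp (real l * s / 2) * exp (- (real l * s))"
      by (intro mult_right_mono) auto
    also have "\<dots> = ?C * s powr (1 - q) * exp (- s / 2) ^ l"
      by (simp add: mult.assoc flip: exp_add exp_of_nat_mult)
    finally show ?thesis .
  qed
  have r: "exp (- s / 2) < 1" using s by simp
  have "(\<Sum>l=1..n. exp (- s / 2) ^ l) \<le> exp (- s / 2) / (1 - exp (- s / 2))"
    using r by (simp add: sum_gp divide_right_mono)
  also have "\<dots> = 1 / (exp (s / 2) - 1)"
    using s by (simp add: field_simps exp_minus)
  also have "\<dots> \<le> 2 / s"
    using exp_ge_add_one_self[of "s / 2"] s by (simp add: field_simps)
  finally have geo: "(\<Sum>l=1..n. exp (- s / 2) ^ l) \<le> 2 / s" .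
  have "(\<Sum>l=1..n. real l powr (q - 1) * exp (- (real l * s))) \<le>
      (\<Sum>l=1..n. ?C * s powr (1 - q) * exp (- s / 2) ^ l)"
    by (rule sum_mono) (rule term_le)
  also have "\<dots> = ?C * s powr (1 - q) * (\<Sum>l=1..n. exp (- s / 2) ^ l)"
    by (simp only: sum_distrib_left)
  also have "\<dots> \<le> ?C * s powr (1 - q) * (2 / s)"
    using geo by (intro mult_left_mono) auto
  also have "\<dots> = 2 * ?C * s powr - q"
    using s by (simp add: powr_diff powr_minus divide_simps)
  finally show ?thesis .
qed

text \<open>Only the indices above \<open>n div 2\<close> are kept: there are at least
  \<open>n / 2\<close> of them, each contributing at least \<open>(n / 2) powr q\<close>.\<close>

lemma sum_powr_ge:
  fixes q :: real
  assumes "q \<ge> 0" "n \<ge> 1"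
  shows "(real n / 2) powr (q + 1) \<le> (\<Sum>l=1..n. real l powr q)"
proof -
  have "(real n / 2) powr (q + 1) = real n / 2 * (real n / 2) powr q"
    using assms by (simp add: powr_add)
  also have "\<dots> \<le> real (card {n div 2 + 1..n}) * (real n / 2) powr q"
    by (intro mult_right_mono) auto
  also have "\<dots> \<le> (\<Sum>l=n div 2 + 1..n. real l powr q)"
  proof (rule sum_bounded_below)
    fix l assume "l \<in> {n div 2 + 1..n}"
    then have "real n / 2 \<le> real l" by auto
    then show "(real n / 2) powr q \<le> real l powr q"
      using assms by (intro powr_mono2) auto
  qed
  also have "\<dots> \<le> (\<Sum>l=1..n. real l powr q)"
    by (intro sum_mono2) auto
  finally show ?thesis .
qed

text \<open>The finitely many ratios below the threshold are positive, so a minimum and a maximum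
  absorb them into the constants.\<close>

lemma global_powr_bounds:
  fixes a :: "nat \<Rightarrow> real" and q :: real
  assumes pos: "\<And>j. j \<ge> 1 \<Longrightarrow> a j > 0"
    and ev: "\<exists>\<gamma>1>0. \<exists>\<gamma>2>0. \<forall>\<^sub>F j in sequentially.
           \<gamma>1 * real j powr q \<le> a j \<and> a j \<le> \<gamma>2 * real j powr q"
  shows "\<exists>c1>0. \<exists>c2>0. \<forall>j\<ge>1. c1 * real j powr q \<le> a j \<and> a j \<le> c2 * real j powr q"
proof -
  obtain g1 g2 J where g: "g1 > 0" "g2 > 0"
    and J: "\<And>j. j \<ge> J \<Longrightarrow> g1 * real j powr q \<le> a j \<and> a j \<le> g2 * real j powr q"
    using ev by (auto simp: eventually_sequentially)
  define f where "f j = a j / real j powr q" for j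
  define c1 where "c1 = Min (insert g1 (f ` {1..J}))"
  define c2 where "c2 = Max (insert g2 (f ` {1..J}))"
  have "c1 > 0" "c2 > 0"
    using g pos by (auto simp: c1_def c2_def f_def Max_gr_iff)
  moreover have "c1 * real j powr q \<le> a j \<and> a j \<le> c2 * real j powr q" if "j \<ge> 1" for j
  proof (cases "j \<ge> J")
    case True
    have "c1 \<le> g1" "g2 \<le> c2" by (auto simp: c1_def c2_def)
    then have "c1 * real j powr q \<le> g1 * real j powr q" "g2 * real j powr q \<le> c2 * real j powr q"
      by (auto intro: mult_right_mono)
    with J[OF True] show ?thesis by auto
  next
    case False
    then have "f j \<in> f ` {1..J}" using that by auto
    then have "c1 \<le> f j" "f j \<le> c2"
      unfolding c1_def c2_def by (intro Min_le Max_ge; simp)+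
    then show ?thesis using that by (auto simp: f_def field_simps)
  qed
  ultimately show ?thesis by blast
qed

section \<open>Weights of power growth\<close>

lemma powr_divide_eq:
  fixes c q s :: real
  shows "c powr q * s powr - q = (c / s) powr q"
  by (simp add: powr_divide powr_minus_divide)

text \<open>\<open>N\<close> is the cutoff up to which \<open>exp (- (real l * s))\<close> stays
  above \<open>exp (- 1)\<close>. The last bound holds because
  \<open>1 / s < N + 1 \<le> 2 * N\<close>.\<close>

lemma floor_inverse_bounds:
  fixes s :: real
  assumes "0 < s" "s \<le> 1" "N = nat \<lfloor>1 / s\<rfloor>"
  shows "N \<ge> 1" "real N * s \<le> 1" "1 / (2 * s) \<le> real N"
proof -
  have 1: "1 \<le> 1 / s" using assms by simp
  then have fl: "\<lfloor>1 / s\<rfloor> \<ge> 1" by (simp add: le_floor_iff)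
  then show "N \<ge> 1" using assms by linarith
  have N: "real N = of_int \<lfloor>1 / s\<rfloor>" using fl assms by simp
  have "real N \<le> 1 / s" unfolding N by (rule of_int_floor_le)
  then show "real N * s \<le> 1" using assms(1) by (simp only: pos_le_divide_eq)
  have "1 / s < real N + 1" unfolding N by linarith
  then show "1 / (2 * s) \<le> real N"
    using \<open>N \<ge> 1\<close> by (simp add: field_simps)
qed

locale powr_weights =
  fixes a :: "nat \<Rightarrow> real" and p c1 c2 :: real
  assumes p: "p > 0" and c1: "c1 > 0" and c2: "c2 > 0"
    and a_ge: "\<And>l. l \<ge> 1 \<Longrightarrow> c1 * real l powr (p - 1) \<le> a l"
    and a_le: "\<And>l. l \<ge> 1 \<Longrightarrow> a l \<le> c2 * real l powr (p - 1)"
begin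

lemma a_pos: "l \<ge> 1 \<Longrightarrow> a l > 0"
  using a_ge[of l] c1 by (auto intro: less_le_trans[rotated])

text \<open>The factor \<open>2 * (2 * (q - 1)) powr (q - 1)\<close> is the constant of \<open>sum_powr_exp_le\<close>
  at \<open>q = p + k\<close>.\<close>

definition moment_bd :: "nat \<Rightarrow> real" where
  "moment_bd k = c2 * (2 * (2 * (p + real k - 1)) powr (p + real k - 1))"

lemma moment_bd_nonneg: "moment_bd k \<ge> 0"
  using c2 by (simp add: moment_bd_def)

text \<open>The upper bound on \<open>a\<close> reduces this to \<open>sum_powr_exp_le\<close> with
  \<open>q = p + k\<close>, which exceeds 1 because \<open>k \<ge> 1\<close>, even when
  \<open>p < 1\<close>.\<close>

lemma moment_le:
  assumes "s > 0" "k \<ge> 1"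
  shows "(\<Sum>l=1..n. real l ^ k * a l * exp (- (real l * s))) \<le> moment_bd k * s powr - (p + real k)"
proof -
  have "real l ^ k * a l * exp (- (real l * s)) \<le>
      c2 * (real l powr (p + real k - 1) * exp (- (real l * s)))" if "l \<in> {1..n}" for l
  proof -
    have "real l ^ k * a l \<le> real l ^ k * (c2 * real l powr (p - 1))"
      using a_le[of l] that by (intro mult_left_mono) auto
    also have "\<dots> = c2 * real l powr (p + real k - 1)"
      using that by (simp add: powr_add powr_diff powr_realpow)
    finally have "real l ^ k * a l * exp (- (real l * s)) \<le>
        c2 * real l powr (p + real k - 1) * exp (- (real l * s))"
      by (intro mult_right_mono) auto
    then show ?thesis by (simp add: mult.assoc)
  qed
  then have "(\<Sum>l=1..n. real l ^ k * a l * exp (- (real l * s))) \<le>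
      (\<Sum>l=1..n. c2 * (real l powr (p + real k - 1) * exp (- (real l * s))))"
    by (rule sum_mono)
  also have "\<dots> = c2 * (\<Sum>l=1..n. real l powr (p + real k - 1) * exp (- (real l * s)))"
    by (simp only: sum_distrib_left)
  also have "\<dots> \<le> c2 * (2 * (2 * (p + real k - 1)) powr (p + real k - 1) * s powr - (p + real k))"
    using p c2 assms by (intro mult_left_mono sum_powr_exp_le) auto
  finally show ?thesis by (simp add: moment_bd_def mult.assoc)
qed

text \<open>For \<open>l \<le> N\<close> the exponential is at least \<open>exp (- K)\<close>, and
  \<open>sum_powr_ge\<close> bounds the remaining power sum. The sign of \<open>s\<close> is left
  open, since the lemma is applied to \<open>tilt a n\<close> before that is known to be
  positive.\<close>

lemma moment_ge:
  assumes "k \<ge> 1" "N \<ge> 1" "N \<le> n" "real N * s \<le> K" "K \<ge> 0"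
  shows "exp (- K) * c1 * (real N / 2) powr (p + real k) \<le>
    (\<Sum>l=1..n. real l ^ k * a l * exp (- (real l * s)))"
proof -
  have "exp (- K) * c1 * (real N / 2) powr (p + real k - 1 + 1) \<le>
      exp (- K) * c1 * (\<Sum>l=1..N. real l powr (p + real k - 1))"
    using p c1 assms by (intro mult_left_mono sum_powr_ge) auto
  also have "\<dots> = (\<Sum>l=1..N. exp (- K) * c1 * real l powr (p + real k - 1))"
    by (simp only: sum_distrib_left)
  also have "\<dots> \<le> (\<Sum>l=1..N. real l ^ k * a l * exp (- (real l * s)))"
  proof (rule sum_mono)
    fix l assume l: "l \<in> {1..N}"
    have "real l * s \<le> K"
    proof (cases "s \<ge> 0")
      case True
      then have "real l * s \<le> real N * s" using l by (intro mult_right_mono) auto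
      then show ?thesis using assms by simp
    next
      case False
      then have "real l * s \<le> 0" by (intro mult_nonneg_nonpos) auto
      then show ?thesis using assms by simp
    qed
    then have e: "exp (- K) \<le> exp (- (real l * s))" by simp
    have "real l ^ k * (c1 * real l powr (p - 1)) \<le> real l ^ k * a l"
      using a_ge[of l] l by (intro mult_left_mono) auto
    also have "real l ^ k * (c1 * real l powr (p - 1)) = c1 * real l powr (p + real k - 1)"
      using l by (simp add: powr_add powr_diff powr_realpow)
    finally have "c1 * real l powr (p + real k - 1) \<le> real l ^ k * a l" .
    from mult_mono[OF e this] c1
    have "exp (- K) * (c1 * real l powr (p + real k - 1)) \<le> exp (- (real l * s)) * (real l ^ k * a l)"
      by simp
    then show "exp (- K) * c1 * real l powr (p + real k - 1) \<le> real l ^ k * a l * exp (- (real l * s))"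
      by (simp add: ac_simps)
  qed
  also have "\<dots> \<le> (\<Sum>l=1..n. real l ^ k * a l * exp (- (real l * s)))"
    using a_pos assms by (intro sum_mono2) (auto intro!: mult_nonneg_nonneg less_imp_le)
  finally show ?thesis by simp
qed

text \<open>For a sum of independent \<open>l\<close>-fold Poisson variables with means
  \<open>a l * exp (- (real l * s))\<close>, this is minus the logarithm of the modulus of the
  characteristic function at frequency \<open>z\<close>; \<open>var\<close> below is the variance.
  Keeping \<open>s\<close> free makes the estimates uniform in it.\<close>

definition expo :: "real \<Rightarrow> nat \<Rightarrow> real \<Rightarrow> real" where
  "expo s n z = (\<Sum>l=1..n. a l * exp (- (real l * s)) * (1 - cos (2 * pi * z * real l)))"

definition var :: "real \<Rightarrow> nat \<Rightarrow> real" where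
  "var s n = (\<Sum>l=1..n. real l ^ 2 * a l * exp (- (real l * s)))"

section \<open>Lower bounds for the exponent near zero and away from zero\<close>

lemma expo_summand_nonneg:
  "l \<ge> 1 \<Longrightarrow> 0 \<le> a l * exp (- (real l * s)) * (1 - cos (2 * pi * z * real l))"
  using a_pos[of l] by (intro mult_nonneg_nonneg) auto

lemma expo_nonneg: "0 \<le> expo s n z"
  unfolding expo_def by (intro sum_nonneg expo_summand_nonneg) auto

text \<open>For \<open>l \<le> N\<close> the argument satisfies
  \<open>\<bar>z * l\<bar> \<le> 1 / 2\<close>, so the quadratic bound on \<open>1 - cos\<close>
  applies termwise. It yields \<open>8 * z\<^sup>2\<close> times the variance truncated at
  \<open>N\<close>, estimated by \<open>moment_ge\<close>.\<close>

lemma expo_ge_near: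
  assumes "N \<ge> 1" "N \<le> n" "real N * s \<le> 1" "\<bar>z\<bar> * (2 * real N) \<le> 1"
  shows "8 * exp (- 1) * c1 * z\<^sup>2 * (real N / 2) powr (p + 2) \<le> expo s n z"
proof -
  have "8 * z\<^sup>2 * (exp (- 1) * c1 * (real N / 2) powr (p + real 2)) \<le> 8 * z\<^sup>2 * var s N"
    unfolding var_def using assms by (intro mult_left_mono moment_ge) auto
  also have "\<dots> = (\<Sum>l=1..N. 8 * z\<^sup>2 * (real l ^ 2 * a l * exp (- (real l * s))))"
    by (simp only: sum_distrib_left var_def)
  also have "\<dots> \<le> (\<Sum>l=1..N. a l * exp (- (real l * s)) * (1 - cos (2 * pi * z * real l)))"
  proof (rule sum_mono)
    fix l assume l: "l \<in> {1..N}"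
    have "\<bar>z\<bar> * (2 * real l) \<le> \<bar>z\<bar> * (2 * real N)"
      using l by (intro mult_left_mono) auto
    then have "\<bar>z * real l\<bar> \<le> 1 / 2"
      using assms by (simp add: abs_mult)
    then have "8 * (z * real l)\<^sup>2 \<le> 1 - cos (2 * pi * (z * real l))"
      by (rule one_minus_cos_ge)
    then have "a l * exp (- (real l * s)) * (8 * (z * real l)\<^sup>2) \<le>
        a l * exp (- (real l * s)) * (1 - cos (2 * pi * (z * real l)))"
      using a_pos[of l] l by (intro mult_left_mono) auto
    then show "8 * z\<^sup>2 * (real l ^ 2 * a l * exp (- (real l * s))) \<le>
        a l * exp (- (real l * s)) * (1 - cos (2 * pi * z * real l))"
      by (simp add: power_mult_distrib ac_simps)
  qed
  also have "\<dots> \<le> expo s n z"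
    unfolding expo_def using assms by (intro sum_mono2 expo_summand_nonneg) auto
  finally show ?thesis by (simp add: ac_simps)
qed

text \<open>Of the \<open>2 * N\<close> indices in \<open>{N+1..3*N}\<close> the cosines sum to at
  most \<open>1 / (2 * \<bar>z\<bar>) \<le> N\<close>, so the terms \<open>1 - cos\<close> sum to at
  least \<open>N\<close>. All weights on this block are at least \<open>w\<close>, of order
  \<open>N powr (p - 1)\<close>.\<close>

lemma expo_ge_far:
  assumes "N \<ge> 1" "3 * N \<le> n" "s \<ge> 0" "real N * s \<le> 1" "\<bar>z\<bar> * (2 * real N) \<ge> 1" "\<bar>z\<bar> \<le> 1 / 2"
  shows "exp (- 3) * c1 * min 1 (3 powr (p - 1)) * real N powr p \<le> expo s n z"
proof -
  \<comment> \<open>The minimum covers both monotonicities of \<open>l powr (p - 1)\<close>: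
    \<open>l \<ge> N\<close> is used for \<open>p \<ge> 1\<close>, and \<open>l \<le> 3 * N\<close>
    for \<open>p < 1\<close>.\<close>
  define d where "d = min 1 (3 powr (p - 1))"
  define w where "w = exp (- 3) * (c1 * (d * real N powr (p - 1)))"
  have d: "d > 0" by (simp add: d_def)
  have w: "w \<ge> 0" using c1 d by (simp add: w_def)
  have z: "z \<noteq> 0" using assms by auto
  have "(\<Sum>l=N+1..N+2*N. cos (2 * pi * z * real l)) \<le> 1 / (2 * \<bar>z\<bar>)"
    using assms z by (intro sum_cos_le) auto
  also have "\<dots> \<le> real N"
    using assms z by (simp add: field_simps)
  finally have "real N \<le> (\<Sum>l=N+1..N+2*N. 1 - cos (2 * pi * z * real l))"
    by (simp add: sum_subtractf)
  then have "w * real N \<le> w * (\<Sum>l=N+1..N+2*N. 1 - cos (2 * pi * z * real l))"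
    using w by (rule mult_left_mono)
  also have "\<dots> = (\<Sum>l=N+1..N+2*N. w * (1 - cos (2 * pi * z * real l)))"
    by (simp only: sum_distrib_left)
  also have "\<dots> \<le> (\<Sum>l=N+1..N+2*N. a l * exp (- (real l * s)) * (1 - cos (2 * pi * z * real l)))"
  proof (intro sum_mono mult_right_mono)
    fix l assume l: "l \<in> {N+1..N+2*N}"
    have "d * real N powr (p - 1) \<le> real l powr (p - 1)"
    proof (cases "p \<ge> 1")
      case True
      have "d * real N powr (p - 1) \<le> 1 * real N powr (p - 1)"
        by (intro mult_right_mono) (auto simp: d_def)
      also have "\<dots> \<le> real l powr (p - 1)"
        using l True by (simp add: powr_mono2)
      finally show ?thesis .
    next
      case False
      have "d * real N powr (p - 1) \<le> 3 powr (p - 1) * real N powr (p - 1)"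
        by (intro mult_right_mono) (auto simp: d_def)
      also have "\<dots> = (3 * real N) powr (p - 1)"
        by (simp add: powr_mult)
      also have "\<dots> \<le> real l powr (p - 1)"
        using l False assms by (intro powr_mono2') auto
      finally show ?thesis .
    qed
    then have "c1 * (d * real N powr (p - 1)) \<le> c1 * real l powr (p - 1)"
      using c1 by (intro mult_left_mono) auto
    also have "\<dots> \<le> a l" using a_ge[of l] l by simp
    finally have "c1 * (d * real N powr (p - 1)) \<le> a l" .
    moreover have "real l * s \<le> 3 * real N * s"
      using l assms by (intro mult_right_mono) auto
    then have "exp (- 3) \<le> exp (- (real l * s))" using assms by simp
    ultimately have "w \<le> exp (- (real l * s)) * a l"
      unfolding w_def using c1 d by (intro mult_mono) auto
    then show "w \<le> a l * exp (- (real l * s))" by (simp add: mult.commute)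
  qed auto
  also have "\<dots> \<le> expo s n z"
    unfolding expo_def using assms by (intro sum_mono2 expo_summand_nonneg) auto
  also have "w * real N = exp (- 3) * c1 * d * real N powr p"
    using assms by (simp add: w_def powr_diff)
  finally show ?thesis by (simp add: d_def)
qed

text \<open>On the near range the exponent is at least a multiple of the variance times \<open>z\<^sup>2\<close>;
  on the far range it is at least a multiple of \<open>s powr - p\<close>, whose exponential beats
  the variance, of order \<open>s powr - (p + 2)\<close>.\<close>

lemma expo_decay:
  "\<exists>C>0. \<forall>s n z. 0 < s \<longrightarrow> s \<le> 1 \<longrightarrow> 3 \<le> real n * s \<longrightarrow> \<bar>z\<bar> \<le> 1 / 2 \<longrightarrow>
     1 + z\<^sup>2 * var s n \<le> C * exp (expo s n z)"
proof -
  \<comment> \<open>\<open>D\<close> and \<open>E\<close> come from the near and far bounds with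
    \<open>N \<ge> 1 / (2 * s)\<close> inserted. \<open>F\<close> is the constant of
    \<open>powr_le_exp\<close> for exponent \<open>(p + 2) / p\<close> and rate
    \<open>E\<close>.\<close>
  define D where "D = 8 * exp (- 1) * c1 * (1 / 4) powr (p + 2)"
  define E where "E = exp (- 3) * c1 * min 1 (3 powr (p - 1)) * (1 / 2) powr p"
  define F where "F = ((p + 2) / p / E) powr ((p + 2) / p)"
  define C where "C = 1 + moment_bd 2 / D + moment_bd 2 * F"
  have D: "D > 0" and E: "E > 0" using c1 by (auto simp: D_def E_def)
  have "C > 0"
    unfolding C_def using moment_bd_nonneg[of 2] D by (intro add_pos_nonneg) (auto simp: F_def)
  moreover have "1 + z\<^sup>2 * var s n \<le> C * exp (expo s n z)"
    if s: "0 < s" "s \<le> 1" and n: "3 \<le> real n * s" and z: "\<bar>z\<bar> \<le> 1 / 2" for s z n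
  proof -
    define N where "N = nat \<lfloor>1 / s\<rfloor>"
    note N = floor_inverse_bounds[OF s N_def]
    \<comment> \<open>The assumption \<open>3 \<le> real n * s\<close> is what keeps the whole block
      up to \<open>3 * N\<close> inside \<open>{1..n}\<close>.\<close>
    have N_le: "3 * real N \<le> real n"
      using N(2) n s by (metis (no_types, lifting) mult.assoc mult_le_cancel_right_pos mult_left_mono
        mult_1_right order_trans zero_le_numeral)
    then have Nn: "3 * N \<le> n" "N \<le> n" by auto
    have V: "var s n \<le> moment_bd 2 * s powr - (p + 2)"
      using moment_le[OF s(1), of 2 n] by (simp add: var_def)
    have "var s n \<ge> 0"
      unfolding var_def using a_pos by (intro sum_nonneg) (auto intro!: mult_nonneg_nonneg less_imp_le)
    have exp_ge: "1 \<le> exp (expo s n z)" "expo s n z \<le> exp (expo s n z)"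
      using expo_nonneg[of s n z] exp_ge_add_one_self[of "expo s n z"] by (simp, linarith)
    have le: "z\<^sup>2 * var s n \<le> (moment_bd 2 / D + moment_bd 2 * F) * exp (expo s n z)"
    proof (cases "\<bar>z\<bar> * (2 * real N) \<le> 1")
      case True
      have "(1 / 4) powr (p + 2) * s powr - (p + 2) = (1 / (2 * s) / 2) powr (p + 2)"
        using s powr_divide_eq[of "1 / 4" "p + 2" s] by simp
      also have "\<dots> \<le> (real N / 2) powr (p + 2)"
        using N p s by (intro powr_mono2 divide_right_mono) auto
      finally have "8 * exp (- 1) * c1 * z\<^sup>2 * ((1 / 4) powr (p + 2) * s powr - (p + 2)) \<le>
          8 * exp (- 1) * c1 * z\<^sup>2 * (real N / 2) powr (p + 2)"
        using c1 by (intro mult_left_mono) auto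
      also have "\<dots> \<le> expo s n z"
        using N Nn True by (intro expo_ge_near) auto
      finally have S: "D * (z\<^sup>2 * s powr - (p + 2)) \<le> expo s n z"
        by (simp add: D_def ac_simps)
      have "z\<^sup>2 * var s n \<le> z\<^sup>2 * (moment_bd 2 * s powr - (p + 2))"
        using V by (intro mult_left_mono) auto
      also have "\<dots> = moment_bd 2 / D * (D * (z\<^sup>2 * s powr - (p + 2)))"
        using D by simp
      also have "\<dots> \<le> moment_bd 2 / D * exp (expo s n z)"
        using S exp_ge moment_bd_nonneg D by (intro mult_left_mono) auto
      also have "\<dots> \<le> (moment_bd 2 / D + moment_bd 2 * F) * exp (expo s n z)"
        using moment_bd_nonneg[of 2] by (intro mult_right_mono) (auto simp: F_def)
      finally show ?thesis .
    next
      case False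
      have "(1 / 2) powr p * s powr - p = (1 / (2 * s)) powr p"
        using s by (simp add: powr_divide powr_minus_divide powr_mult)
      also have "\<dots> \<le> real N powr p"
        using N p s by (intro powr_mono2) auto
      finally have "exp (- 3) * c1 * min 1 (3 powr (p - 1)) * ((1 / 2) powr p * s powr - p) \<le>
          exp (- 3) * c1 * min 1 (3 powr (p - 1)) * real N powr p"
        using c1 by (intro mult_left_mono) auto
      also have "\<dots> \<le> expo s n z"
        using N Nn s z False by (intro expo_ge_far) auto
      finally have S: "E * s powr - p \<le> expo s n z"
        by (simp add: E_def ac_simps)
      \<comment> \<open>Written as a power of \<open>s powr - p\<close>, the size of the variance is
        dominated by an exponential of the far lower bound.\<close>
      have "s powr - (p + 2) = (s powr - p) powr ((p + 2) / p)"
        using p by (simp add: powr_powr)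
      also have "\<dots> \<le> F * exp (E * s powr - p)"
        unfolding F_def using p s E by (intro powr_le_exp) auto
      also have "\<dots> \<le> F * exp (expo s n z)"
        using S by (intro mult_left_mono) (auto simp: F_def)
      finally have "moment_bd 2 * s powr - (p + 2) \<le> moment_bd 2 * (F * exp (expo s n z))"
        using moment_bd_nonneg by (intro mult_left_mono) auto
      with V have "var s n \<le> moment_bd 2 * F * exp (expo s n z)" by simp
      moreover have "z\<^sup>2 * var s n \<le> 1 * var s n"
        using z \<open>var s n \<ge> 0\<close> abs_square_le_1[of z] by (intro mult_right_mono) auto
      moreover have "moment_bd 2 * F * exp (expo s n z) \<le>
          (moment_bd 2 / D + moment_bd 2 * F) * exp (expo s n z)"
        using moment_bd_nonneg[of 2] D by (intro mult_right_mono) auto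
      ultimately show ?thesis by linarith
    qed
    from add_mono[OF exp_ge(1) le] show ?thesis by (simp add: C_def distrib_right)
  qed
  ultimately show ?thesis by blast
qed

section \<open>Order of the variance and the third moment\<close>

lemma var_ge:
  assumes "0 < s" "s \<le> 1" "1 \<le> real n * s"
  shows "exp (- 1) * c1 * (1 / 4) powr (p + 2) * s powr - (p + 2) \<le> var s n"
proof -
  define N where "N = nat \<lfloor>1 / s\<rfloor>"
  note N = floor_inverse_bounds[OF assms(1,2) N_def]
  have "real N * s \<le> real n * s" using N(2) assms(3) by (rule order_trans)
  then have Nn: "N \<le> n" using assms(1) by (simp only: mult_le_cancel_right_pos of_nat_le_iff)
  have "(1 / 4) powr (p + 2) * s powr - (p + 2) = (1 / (2 * s) / 2) powr (p + 2)"
    using assms powr_divide_eq[of "1 / 4" "p + 2" s] by simp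
  also have "\<dots> \<le> (real N / 2) powr (p + 2)"
    using N p assms by (intro powr_mono2 divide_right_mono) auto
  finally have "exp (- 1) * c1 * ((1 / 4) powr (p + 2) * s powr - (p + 2)) \<le>
      exp (- 1) * c1 * (real N / 2) powr (p + real 2)"
    using c1 by (intro mult_left_mono) auto
  also have "\<dots> \<le> var s n"
    unfolding var_def using N Nn by (intro moment_ge) auto
  finally show ?thesis by (simp add: mult.assoc)
qed

text \<open>A Lyapunov ratio: the third moment is \<open>O(s powr - (p + 3))\<close>, while
  \<open>var_ge\<close> bounds the cubed standard deviation below by a multiple of
  \<open>s powr (- 3 * (p + 2) / 2)\<close>. The exponents differ by \<open>p / 2\<close>.\<close>

lemma third_moment_le:
  "\<exists>C. \<forall>s n. 0 < s \<longrightarrow> s \<le> 1 \<longrightarrow> 1 \<le> real n * s \<longrightarrow>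
     (\<Sum>l=1..n. real l ^ 3 * a l * exp (- (real l * s))) \<le> C * s powr (p / 2) * sqrt (var s n) ^ 3"
proof -
  define D where "D = exp (- 1) * c1 * (1 / 4) powr (p + 2)"
  have D: "D > 0" using c1 by (simp add: D_def)
  have "(\<Sum>l=1..n. real l ^ 3 * a l * exp (- (real l * s))) \<le>
      moment_bd 3 / sqrt D ^ 3 * s powr (p / 2) * sqrt (var s n) ^ 3"
    if s: "0 < s" "s \<le> 1" "1 \<le> real n * s" for s n
  proof -
    have "sqrt (s powr - (p + 2)) ^ 3 = s powr (- (p + 2) / 2 * 3)"
      using s by (simp add: powr_half_sqrt[symmetric] powr_powr flip: powr_realpow)
    then have "s powr - (p + 3) = s powr (p / 2) * sqrt (s powr - (p + 2)) ^ 3"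
      by (simp only: powr_add[symmetric]) (simp add: algebra_simps add_divide_distrib diff_divide_distrib)
    then have "s powr - (p + 3) = 1 / sqrt D ^ 3 * s powr (p / 2) * sqrt (D * s powr - (p + 2)) ^ 3"
      using D by (simp add: real_sqrt_mult power_mult_distrib)
    also have "\<dots> \<le> 1 / sqrt D ^ 3 * s powr (p / 2) * sqrt (var s n) ^ 3"
      using var_ge[OF s] D unfolding D_def[symmetric]
      by (intro mult_left_mono power_mono real_sqrt_le_mono) auto
    finally have "moment_bd 3 * s powr - (p + 3) \<le>
        moment_bd 3 * (1 / sqrt D ^ 3 * s powr (p / 2) * sqrt (var s n) ^ 3)"
      using moment_bd_nonneg by (intro mult_left_mono) auto
    with moment_le[OF s(1), of 3 n] show ?thesis by simp
  qed
  then show ?thesis by blast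
qed

section \<open>Size of the tilting parameter\<close>

lemma tilt_eq:
  assumes "n \<ge> 1"
  shows "(\<Sum>l=1..n. real l * a l * exp (- (real l * tilt a n))) = real n"
  unfolding tilt_def by (rule theI', rule tilt_ex1[OF a_pos assms])

text \<open>Otherwise all exponentials are at least \<open>exp (- 3)\<close>, and the first moment
  is at least \<open>D * n powr (p + 1)\<close>. For large \<open>n\<close> this exceeds its
  prescribed value \<open>n\<close>. The constant 3 is the one \<open>expo_decay\<close>
  requires.\<close>

lemma eventually_tilt_ge: "\<forall>\<^sub>F n in sequentially. 3 \<le> real n * tilt a n"
proof -
  define D where "D = exp (- 3) * c1 * (1 / 2) powr (p + 1)"
  have D: "D > 0" using c1 by (simp add: D_def)
  have "filterlim (\<lambda>n. real n powr p) at_top sequentially"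
    using p by real_asymp
  then have "\<forall>\<^sub>F n in sequentially. real n powr p > 1 / D"
    by (simp add: filterlim_at_top_dense)
  then show ?thesis
    using eventually_ge_at_top[of 1]
  proof eventually_elim
    case (elim n)
    show ?case
    proof (rule ccontr)
      assume "\<not> 3 \<le> real n * tilt a n"
      then have "exp (- 3) * c1 * (real n / 2) powr (p + real 1) \<le>
          (\<Sum>l=1..n. real l ^ 1 * a l * exp (- (real l * tilt a n)))"
        using elim by (intro moment_ge) auto
      also have "\<dots> = real n" using tilt_eq[of n] elim by simp
      also have "exp (- 3) * c1 * (real n / 2) powr (p + real 1) = D * real n powr p * real n"
        using elim by (simp add: D_def powr_divide powr_add)
      finally have "D * real n powr p \<le> 1" using elim by simp
      with elim D show False by (simp add: field_simps)
    qed
  qed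
qed

lemma tilt_pos: "3 \<le> real n * tilt a n \<Longrightarrow> tilt a n > 0"
  by (metis less_le_trans not_le of_nat_0_le_iff mult_nonneg_nonpos zero_less_numeral)

text \<open>The first moment equals \<open>n\<close> and is at most
  \<open>C * tilt a n powr - (p + 1)\<close>; solving for the tilt gives an explicit null sequence
  as upper bound.\<close>

lemma tilt_tendsto_0: "tilt a \<longlonglongrightarrow> 0"
proof -
  define C where "C = moment_bd 1"
  have lim: "(\<lambda>n. (C / real n) powr (1 / (p + 1))) \<longlonglongrightarrow> 0"
    using moment_bd_nonneg[of 1] p unfolding C_def[symmetric]
    by (intro tendsto_zero_powrI[where b = "1 / (p + 1)"] tendsto_intros lim_const_over_n) auto
  have bd: "\<forall>\<^sub>F n in sequentially. 0 \<le> tilt a n \<and> tilt a n \<le> (C / real n) powr (1 / (p + 1))"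
    using eventually_tilt_ge eventually_ge_at_top[of 1]
  proof eventually_elim
    case (elim n)
    then have pos: "tilt a n > 0" by (intro tilt_pos)
    have "real n = (\<Sum>l=1..n. real l ^ 1 * a l * exp (- (real l * tilt a n)))"
      using tilt_eq[of n] elim by simp
    also have "\<dots> \<le> C * tilt a n powr - (p + 1)"
      using moment_le[OF pos, of 1 n] by (simp add: C_def)
    finally have "real n \<le> C / tilt a n powr (p + 1)"
      by (simp only: powr_minus_divide times_divide_eq_right mult_1_right)
    then have "tilt a n powr (p + 1) \<le> C / real n"
      using pos elim by (simp add: pos_le_divide_eq mult.commute)
    then have "(tilt a n powr (p + 1)) powr (1 / (p + 1)) \<le> (C / real n) powr (1 / (p + 1))"
      using p by (intro powr_mono2) auto
    then show ?case using p pos by (simp add: powr_powr)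
  qed
  show ?thesis
    by (rule tendsto_sandwich[OF _ _ tendsto_const lim]) (use bd in \<open>auto elim: eventually_mono\<close>)
qed

end

section \<open>Characteristic functions of integer random variables\<close>

text \<open>Orthogonality of the characters over one period. The left end \<open>c\<close> is free
  because both \<open>{0..1}\<close> and the interval symmetric about 0 are needed.\<close>

lemma has_bochner_integral_exp_period:
  fixes k :: int and c :: real
  shows "has_bochner_integral lborel
    (\<lambda>\<alpha>. indicator {c..c+1} \<alpha> *\<^sub>R exp (2 * complex_of_real pi * \<i> * complex_of_real \<alpha> * of_int k))
    (if k = 0 then 1 else 0)"
proof (cases "k = 0")
  case True
  have "has_bochner_integral lborel (\<lambda>\<alpha>. indicator {c..c+1} \<alpha> *\<^sub>R (1::complex))
      (measure lborel {c..c+1} *\<^sub>R 1)"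
    by (intro has_bochner_integral_scaleR_left has_bochner_integral_real_indicator) auto
  then show ?thesis using True by simp
next
  case False
  define w where "w = 2 * complex_of_real pi * \<i> * of_int k"
  have w: "w \<noteq> 0" using False by (simp add: w_def)
  have "has_bochner_integral lborel (\<lambda>\<alpha>. indicator {c..c+1} \<alpha> *\<^sub>R exp (w * complex_of_real \<alpha>))
      (exp (w * complex_of_real (c + 1)) / w - exp (w * complex_of_real c) / w)"
  proof (rule has_bochner_integral_FTC_Icc)
    fix x :: real
    have "((\<lambda>z. exp (w * z) / w) has_field_derivative exp (w * complex_of_real x)) (at (complex_of_real x))"
      using w by (auto intro!: derivative_eq_intros)
    then have "((\<lambda>x. exp (w * complex_of_real x) / w) has_vector_derivative exp (w * complex_of_real x)) (at x)"
      by (rule has_vector_derivative_real_field)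
    then show "((\<lambda>x. exp (w * complex_of_real x) / w) has_vector_derivative exp (w * complex_of_real x))
        (at x within {c..c+1})"
      by (rule has_vector_derivative_at_within)
  qed (auto intro!: continuous_intros)
  moreover have "exp w = 1"
    unfolding w_def exp_eq_1 by (auto intro!: exI[of _ k])
  then have "exp (w * complex_of_real (c + 1)) = exp (w * complex_of_real c)"
    by (simp add: distrib_left exp_add)
  ultimately show ?thesis using False by (simp add: w_def ac_simps)
qed

context prob_space
begin

text \<open>The kernel is bounded and supported on a set of finite product measure, so Fubini
  applies. Integrating over the frequency first leaves the indicator of \<open>Y = n\<close> by
  orthogonality.\<close>

lemma char_fn_inversion:
  fixes Y :: "'a \<Rightarrow> nat" and c :: real
  assumes Y[measurable]: "Y \<in> measurable M (count_space UNIV)"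
  shows "has_bochner_integral lborel (\<lambda>\<alpha>. indicator {c..c+1} \<alpha> *\<^sub>R (char_fn M Y \<alpha> *
            exp (- (2 * complex_of_real pi * \<i> * complex_of_real \<alpha> * of_nat n))))
         (complex_of_real \<P>(\<omega> in M. Y \<omega> = n))"
proof -
  define g where "g \<alpha> \<omega> = indicator {c..c+1} \<alpha> *\<^sub>R
     exp (2 * complex_of_real pi * \<i> * complex_of_real \<alpha> * of_int (int (Y \<omega>) - int n))" for \<alpha> \<omega>
  interpret P: pair_sigma_finite lborel M ..
  have meas[measurable]: "case_prod g \<in> borel_measurable (lborel \<Otimes>\<^sub>M M)"
    unfolding g_def by measurable
  have int: "integrable (lborel \<Otimes>\<^sub>M M) (case_prod g)"
  proof (rule integrableI_bounded_set[where A = "{c..c+1} \<times> space M" and B = 1])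
    show "emeasure (lborel \<Otimes>\<^sub>M M) ({c..c+1} \<times> space M) < \<infinity>"
      by (subst emeasure_pair_measure_Times) (auto simp: emeasure_space_1)
    show "AE x\<in>{c..c+1} \<times> space M in lborel \<Otimes>\<^sub>M M. norm (case_prod g x) \<le> 1"
      by (auto simp: g_def)
    show "AE x in lborel \<Otimes>\<^sub>M M. x \<notin> {c..c+1} \<times> space M \<longrightarrow> case_prod g x = 0"
      by (rule AE_I2) (auto simp: g_def space_pair_measure indicator_def)
  qed auto
  have eq: "(\<integral>\<omega>. g \<alpha> \<omega> \<partial>M) = indicator {c..c+1} \<alpha> *\<^sub>R (char_fn M Y \<alpha> *
            exp (- (2 * complex_of_real pi * \<i> * complex_of_real \<alpha> * of_nat n)))" for \<alpha>
  proof -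
    have "g \<alpha> \<omega> = indicator {c..c+1} \<alpha> *\<^sub>R (exp (2 * complex_of_real pi * \<i> * complex_of_real \<alpha> * of_nat (Y \<omega>)) *
        exp (- (2 * complex_of_real pi * \<i> * complex_of_real \<alpha> * of_nat n)))" for \<omega>
      by (simp add: g_def algebra_simps flip: exp_add)
    then show ?thesis by (simp add: char_fn_def)
  qed
  have "(\<integral>\<alpha>. g \<alpha> \<omega> \<partial>lborel) = complex_of_real (indicator {\<omega>. Y \<omega> = n} \<omega>)" for \<omega>
    using has_bochner_integral_integral_eq[OF has_bochner_integral_exp_period[of c "int (Y \<omega>) - int n"]]
    by (auto simp: g_def)
  then have "(\<integral>\<alpha>. (\<integral>\<omega>. g \<alpha> \<omega> \<partial>M) \<partial>lborel) = (\<integral>\<omega>. complex_of_real (indicator {\<omega>. Y \<omega> = n} \<omega>) \<partial>M)"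
    using P.Fubini_integral[OF int] by simp
  also have "\<dots> = complex_of_real (\<integral>\<omega>. indicator {\<omega>. Y \<omega> = n} \<omega> \<partial>M)"
    by (rule integral_complex_of_real)
  also have "(\<integral>\<omega>. indicator {\<omega>. Y \<omega> = n} \<omega> \<partial>M) = \<P>(\<omega> in M. Y \<omega> = n)"
    by (simp add: Int_def conj_commute)
  finally show ?thesis
    using P.integrable_fst[OF int] by (simp add: has_bochner_integral_iff eq)
qed

text \<open>Passing to the usual characteristic function \<open>char\<close> at
  \<open>2 * pi * \<alpha>\<close> makes its product formula for independent sums available.\<close>

lemma char_fn_sum:
  fixes X :: "nat \<Rightarrow> 'a \<Rightarrow> nat"
  assumes ind: "indep_vars (\<lambda>_. count_space UNIV) X A"
    and Y: "\<And>\<omega>. Y \<omega> = (\<Sum>l\<in>A. X l \<omega>)"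
  shows "char_fn M Y \<alpha> = (\<Prod>l\<in>A. char_fn M (X l) \<alpha>)"
proof -
  have char_fn_eq: "char_fn M Z \<alpha> = char (distr M borel (\<lambda>\<omega>. real (Z \<omega>))) (2 * pi * \<alpha>)"
    if Z[measurable]: "Z \<in> measurable M (count_space UNIV)" for Z
    unfolding char_def
    by (subst integral_distr) (auto simp: char_fn_def ac_simps)
  have rv[measurable]: "X l \<in> measurable M (count_space UNIV)" if "l \<in> A" for l
    using ind that by (auto simp: indep_vars_def)
  have "indep_vars (\<lambda>_. borel) (\<lambda>l \<omega>. real (X l \<omega>)) A"
    by (rule indep_vars_compose2[OF ind]) auto
  from char_distr_sum[OF this, of "2 * pi * \<alpha>"]
  have "char (distr M borel (\<lambda>\<omega>. \<Sum>l\<in>A. real (X l \<omega>))) (2 * pi * \<alpha>) =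
      (\<Prod>l\<in>A. char_fn M (X l) \<alpha>)"
    by (simp add: char_fn_eq rv)
  moreover have "Y \<in> measurable M (count_space UNIV)"
    unfolding Y by (rule measurable_sum_nat) (rule rv)
  ultimately show ?thesis
    by (simp add: char_fn_eq Y)
qed

text \<open>The law is prescribed only at multiples of \<open>l\<close>, but these probabilities
  already sum to 1. Hence other values have mass 0, the law is the image of a Poisson law, and the
  expectation is an exponential series in \<open>w\<close>.\<close>

lemma char_fn_scaled_poisson:
  fixes Z :: "'a \<Rightarrow> nat" and b :: real
  assumes Z[measurable]: "Z \<in> measurable M (count_space UNIV)"
    and b: "b > 0" and l: "l \<ge> 1"
    and law: "\<And>k. \<P>(\<omega> in M. Z \<omega> = l * k) = b ^ k / fact k * exp (- b)"
  shows "char_fn M Z \<alpha> =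
    exp (complex_of_real b * (exp (2 * complex_of_real pi * \<i> * complex_of_real \<alpha> * of_nat l) - 1))"
proof -
  define Q where "Q = map_pmf (\<lambda>k. l * k) (poisson_pmf b)"
  have inj: "inj ((*) l)" using l by (intro injI) auto
  have "(\<lambda>k. prob {\<omega>\<in>space M. Z \<omega> = l * k}) sums prob (\<Union>k. {\<omega>\<in>space M. Z \<omega> = l * k})"
    by (rule finite_measure_UNION) (use l in \<open>auto simp: disjoint_family_on_def\<close>)
  moreover have "(\<lambda>k. b ^ k / fact k * exp (- b)) sums (exp b * exp (- b))"
    using exp_converges[of b] by (intro sums_mult2) (simp add: divide_inverse mult.commute)
  ultimately have one: "prob (\<Union>k. {\<omega>\<in>space M. Z \<omega> = l * k}) = 1"
    by (simp add: law sums_iff flip: exp_add)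
  have distr: "distr M (count_space UNIV) Z = measure_pmf Q"
  proof (rule measure_eqI_countable[where A = UNIV])
    fix m :: nat
    have "prob (Z -` {m} \<inter> space M) = pmf Q m"
    proof (cases "l dvd m")
      case True
      then obtain k where "m = l * k" by auto
      then show ?thesis
        using law[of k] b inj by (simp add: Q_def pmf_map_inj' vimage_def Int_def conj_commute)
    next
      case False
      have "prob (Z -` {m} \<inter> space M) \<le> prob (space M - (\<Union>k. {\<omega>\<in>space M. Z \<omega> = l * k}))"
        using False by (intro finite_measure_mono) auto
      also have "\<dots> = 0" using one by (subst prob_compl) auto
      finally have "prob (Z -` {m} \<inter> space M) = 0"
        using measure_nonneg[of M "Z -` {m} \<inter> space M"] by linarith
      moreover have "m \<notin> set_pmf Q" using False b by (auto simp: Q_def)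
      ultimately show ?thesis by (simp add: pmf_eq_0_set_pmf)
    qed
    then show "emeasure (distr M (count_space UNIV) Z) {m} = emeasure (measure_pmf Q) {m}"
      by (simp add: emeasure_distr emeasure_eq_measure emeasure_pmf_single)
  qed auto
  define w where "w = exp (2 * complex_of_real pi * \<i> * complex_of_real \<alpha> * of_nat l)"
  have nw: "norm w = 1" by (simp add: w_def)
  have "char_fn M Z \<alpha> = (\<integral>m. exp (2 * complex_of_real pi * \<i> * complex_of_real \<alpha> * of_nat m)
      \<partial>distr M (count_space UNIV) Z)"
    by (simp add: char_fn_def integral_distr)
  also have "\<dots> = (\<integral>k. w ^ k \<partial>measure_pmf (poisson_pmf b))"
    by (simp add: distr Q_def w_def ac_simps flip: exp_of_nat_mult)
  also have "\<dots> = (\<integral>k. pmf (poisson_pmf b) k *\<^sub>R w ^ k \<partial>count_space UNIV)"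
    unfolding measure_pmf_eq_density by (rule integral_density) (auto simp: pmf_nonneg)
  also have "\<dots> = exp (- complex_of_real b) * exp (complex_of_real b * w)"
  proof (rule sums_unique2)
    have "summable (\<lambda>k. norm (pmf (poisson_pmf b) k *\<^sub>R w ^ k))"
      using b summable_mult2[OF summable_exp[of b], of "exp (- b)"]
      by (simp add: norm_power nw abs_mult divide_inverse mult.commute)
    then show "(\<lambda>k. pmf (poisson_pmf b) k *\<^sub>R w ^ k) sums
        (\<integral>k. pmf (poisson_pmf b) k *\<^sub>R w ^ k \<partial>count_space UNIV)"
      by (intro sums_integral_count_space_nat) (simp add: integrable_count_space_nat_iff)
    have "(\<lambda>k. exp (- complex_of_real b) * ((complex_of_real b * w) ^ k /\<^sub>R fact k)) sums
        (exp (- complex_of_real b) * exp (complex_of_real b * w))"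
      by (intro sums_mult exp_converges)
    moreover have "exp (- complex_of_real b) * ((complex_of_real b * w) ^ k /\<^sub>R fact k) =
        pmf (poisson_pmf b) k *\<^sub>R w ^ k" for k
      using b by (simp add: scaleR_conv_of_real power_mult_distrib divide_inverse exp_of_real[symmetric])
    ultimately show "(\<lambda>k. pmf (poisson_pmf b) k *\<^sub>R w ^ k) sums
        (exp (- complex_of_real b) * exp (complex_of_real b * w))"
      by simp
  qed
  also have "\<dots> = exp (complex_of_real b * (w - 1))"
    by (simp add: algebra_simps flip: exp_add)
  finally show ?thesis by (simp add: w_def)
qed

end

section \<open>The Gaussian limit\<close>

context powr_weights
begin

text \<open>A logarithm of \<open>char_fn\<close> times \<open>exp (- 2 pi i \<alpha> n)\<close> for
  \<open>n \<ge> 1\<close>: by \<open>tilt_eq\<close> the mean is \<open>n\<close>, so the centring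
  factor splits into the linear terms subtracted here.\<close>

definition phase :: "nat \<Rightarrow> real \<Rightarrow> complex" where
  "phase n \<alpha> = (\<Sum>l=1..n. complex_of_real (a l * exp (- (real l * tilt a n))) *
     (iexp (2 * pi * \<alpha> * real l) - 1 - \<i> * complex_of_real (2 * pi * \<alpha> * real l)))"

lemma norm_exp_phase: "norm (exp (phase n \<alpha>)) = exp (- expo (tilt a n) n \<alpha>)"
proof -
  have "Re (phase n \<alpha>) = - expo (tilt a n) n \<alpha>"
    by (simp add: phase_def expo_def Re_sum Re_exp flip: sum_negf) (simp add: algebra_simps)
  then show ?thesis by simp
qed

text \<open>Termwise \<open>l \<le> l\<^sup>2\<close> compares the mean \<open>n\<close> with the
  variance. This gives both positivity of the scale \<open>B\<close> and its divergence.\<close>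

lemma var_tilt_ge: "n \<ge> 1 \<Longrightarrow> real n \<le> var (tilt a n) n"
proof -
  assume n: "n \<ge> 1"
  have "real n = (\<Sum>l=1..n. real l * a l * exp (- (real l * tilt a n)))"
    using tilt_eq[OF n] by simp
  also have "\<dots> \<le> var (tilt a n) n"
    unfolding var_def
  proof (intro sum_mono mult_right_mono)
    fix l assume "l \<in> {1..n}"
    then show "real l \<le> real l ^ 2" "0 \<le> a l"
      using a_pos[of l] self_le_power[of "real l" 2] by auto
  qed auto
  finally show ?thesis .
qed

text \<open>Each exponential is expanded to second order at \<open>x l = t * l / B\<close>. The
  quadratic terms add up to the Gaussian exponent, and the remainders
  \<open>\<bar>x l\<bar> ^ 3 / 6\<close> to the third moment over \<open>B ^ 3\<close>.\<close>

lemma phase_approx: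
  assumes n: "n \<ge> 1"
  defines "B \<equiv> sqrt (var (tilt a n) n)"
  shows "norm (phase n (t / (2 * pi * B)) - complex_of_real (- (t\<^sup>2 / 2))) \<le>
    \<bar>t\<bar> ^ 3 / 6 * ((\<Sum>l=1..n. real l ^ 3 * a l * exp (- (real l * tilt a n))) / B ^ 3)"
proof -
  define b where "b l = a l * exp (- (real l * tilt a n))" for l
  define x where "x l = t / B * real l" for l
  have var: "var (tilt a n) n > 0" using var_tilt_ge[OF n] n by simp
  then have B: "B > 0" by (simp add: B_def)
  have b: "b l \<ge> 0" if "l \<in> {1..n}" for l
    using a_pos[of l] that by (simp add: b_def)
  have ph: "phase n (t / (2 * pi * B)) = (\<Sum>l=1..n. complex_of_real (b l) *
     (iexp (x l) - 1 - \<i> * complex_of_real (x l)))"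
    using B by (simp add: phase_def b_def x_def)
  have taylor: "(\<Sum>k\<le>2. (\<i> * complex_of_real u) ^ k / fact k) =
      1 + \<i> * complex_of_real u - (complex_of_real u)\<^sup>2 / 2" for u
    by (simp add: numeral_2_eq_2 power_mult_distrib)
  \<comment> \<open>No error arises at second order, since \<open>B\<^sup>2\<close> is exactly the
    variance.\<close>
  have "(\<Sum>l=1..n. b l * (x l)\<^sup>2) = (t / B)\<^sup>2 * var (tilt a n) n"
    by (simp add: var_def b_def x_def sum_distrib_left power_mult_distrib power_divide ac_simps)
  also have "\<dots> = t\<^sup>2"
    using var by (simp add: B_def power_divide)
  finally have "complex_of_real (- (t\<^sup>2 / 2)) = complex_of_real (- ((\<Sum>l=1..n. b l * (x l)\<^sup>2) / 2))"
    by simp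
  also have "\<dots> = (\<Sum>l=1..n. complex_of_real (b l) * (- (complex_of_real (x l))\<^sup>2 / 2))"
    by (simp add: sum_divide_distrib sum_negf)
  finally have gauss: "complex_of_real (- (t\<^sup>2 / 2)) =
      (\<Sum>l=1..n. complex_of_real (b l) * (- (complex_of_real (x l))\<^sup>2 / 2))" .
  have "phase n (t / (2 * pi * B)) - complex_of_real (- (t\<^sup>2 / 2)) =
     (\<Sum>l=1..n. complex_of_real (b l) * (iexp (x l) - (\<Sum>k\<le>2. (\<i> * complex_of_real (x l)) ^ k / fact k)))"
    unfolding ph gauss sum_subtractf[symmetric]
    by (intro sum.cong refl, simp only: taylor, simp add: algebra_simps)
  also have "norm \<dots> \<le> (\<Sum>l=1..n. b l * (\<bar>x l\<bar> ^ 3 / 6))"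
  proof (rule sum_norm_le)
    fix l assume l: "l \<in> {1..n}"
    have "norm (iexp (x l) - (\<Sum>k\<le>2. (\<i> * complex_of_real (x l)) ^ k / fact k)) \<le> \<bar>x l\<bar> ^ 3 / 6"
      using iexp_approx1[of "x l" 2] by (simp add: numeral_3_eq_3 fact_numeral eval_nat_numeral)
    from mult_left_mono[OF this b[OF l]] show "norm (complex_of_real (b l) * (iexp (x l) - (\<Sum>k\<le>2. (\<i> * complex_of_real (x l)) ^ k / fact k)))
        \<le> b l * (\<bar>x l\<bar> ^ 3 / 6)"
      unfolding norm_mult using b[OF l] by (simp only: norm_of_real abs_of_nonneg)
  qed
  also have "\<dots> = \<bar>t\<bar> ^ 3 / 6 * ((\<Sum>l=1..n. real l ^ 3 * a l * exp (- (real l * tilt a n))) / B ^ 3)"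
    using B by (simp add: b_def x_def abs_mult power_mult_distrib power_divide sum_distrib_left
      sum_divide_distrib ac_simps)
  finally show ?thesis .
qed

text \<open>\<open>third_moment_le\<close> at the tilt bounds the error for fixed \<open>t\<close>
  by a multiple of \<open>tilt a n powr (p / 2)\<close>, which vanishes as the tilt tends to
  0.\<close>

lemma phase_tendsto:
  "(\<lambda>n. phase n (t / (2 * pi * sqrt (var (tilt a n) n)))) \<longlonglongrightarrow> complex_of_real (- (t\<^sup>2 / 2))"
proof -
  obtain C where C: "\<And>s n. 0 < s \<Longrightarrow> s \<le> 1 \<Longrightarrow> 1 \<le> real n * s \<Longrightarrow>
     (\<Sum>l=1..n. real l ^ 3 * a l * exp (- (real l * s))) \<le> C * s powr (p / 2) * sqrt (var s n) ^ 3"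
    using third_moment_le by blast
  have lim: "(\<lambda>n. \<bar>t\<bar> ^ 3 / 6 * (C * tilt a n powr (p / 2))) \<longlonglongrightarrow> 0"
  proof -
    have "(\<lambda>n. tilt a n powr (p / 2)) \<longlonglongrightarrow> 0"
      using p eventually_tilt_ge
      by (intro tendsto_zero_powrI[OF tilt_tendsto_0 tendsto_const]) (auto elim!: eventually_mono intro: less_imp_le[OF tilt_pos])
    from tendsto_mult_left[OF tendsto_mult_left[OF this, of C], of "\<bar>t\<bar> ^ 3 / 6"] show ?thesis
      by simp
  qed
  have "\<forall>\<^sub>F n in sequentially. tilt a n < 1"
    using tilt_tendsto_0 by (rule order_tendstoD) simp
  then have "\<forall>\<^sub>F n in sequentially. norm (phase n (t / (2 * pi * sqrt (var (tilt a n) n))) -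
      complex_of_real (- (t\<^sup>2 / 2))) \<le> \<bar>t\<bar> ^ 3 / 6 * (C * tilt a n powr (p / 2))"
    using eventually_tilt_ge eventually_ge_at_top[of 1]
  proof eventually_elim
    case (elim n)
    then have s: "tilt a n > 0" by (intro tilt_pos)
    have B: "sqrt (var (tilt a n) n) > 0" using var_tilt_ge[of n] elim by simp
    have "(\<Sum>l=1..n. real l ^ 3 * a l * exp (- (real l * tilt a n))) / sqrt (var (tilt a n) n) ^ 3
        \<le> C * tilt a n powr (p / 2)"
      using C[of "tilt a n" n] elim s B by (simp add: pos_divide_le_eq)
    then have "\<bar>t\<bar> ^ 3 / 6 * ((\<Sum>l=1..n. real l ^ 3 * a l * exp (- (real l * tilt a n))) /
        sqrt (var (tilt a n) n) ^ 3) \<le> \<bar>t\<bar> ^ 3 / 6 * (C * tilt a n powr (p / 2))"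
      by (intro mult_left_mono) auto
    with phase_approx[of n t] elim show ?case by linarith
  qed
  then have "(\<lambda>n. phase n (t / (2 * pi * sqrt (var (tilt a n) n))) - complex_of_real (- (t\<^sup>2 / 2))) \<longlonglongrightarrow> 0"
    by (rule Lim_null_comparison) (rule lim)
  then show ?thesis by (simp only: LIM_zero_iff)
qed

lemma gaussian_limit:
  "(\<lambda>n. \<integral>t. indicator {-1/2..1/2} (t / (2 * pi * sqrt (var (tilt a n) n))) *\<^sub>R
       exp (phase n (t / (2 * pi * sqrt (var (tilt a n) n)))) \<partial>lborel)
   \<longlonglongrightarrow> complex_of_real (sqrt (2 * pi))"
proof -
  define B where "B n = sqrt (var (tilt a n) n)" for n
  define f where "f n t = indicator {-1/2..1/2::real} (t / (2 * pi * B n)) *\<^sub>R exp (phase n (t / (2 * pi * B n)))"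
    for n t
  have B_ge: "sqrt (real n) \<le> B n" if "n \<ge> 1" for n
    using var_tilt_ge[OF that] by (simp add: B_def)
  obtain C where C: "C > 0" "\<And>s n z. 0 < s \<Longrightarrow> s \<le> 1 \<Longrightarrow> 3 \<le> real n * s \<Longrightarrow> \<bar>z\<bar> \<le> 1 / 2 \<Longrightarrow>
     1 + z\<^sup>2 * var s n \<le> C * exp (expo s n z)"
    using expo_decay by blast
  \<comment> \<open>With \<open>z = t / (2 * pi * B n)\<close>, \<open>expo_decay\<close> bounds
    \<open>1 + (t / (2 * pi))\<^sup>2\<close>. Multiplying by
    \<open>(2 * pi)\<^sup>2 \<ge> 1\<close> turns this into a bound on
    \<open>1 + t\<^sup>2\<close>.\<close>
  define w where "w t = C * (2 * pi)\<^sup>2 * inverse (1 + t\<^sup>2)" for t :: real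
  have "\<forall>\<^sub>F n in sequentially. tilt a n < 1"
    using tilt_tendsto_0 by (rule order_tendstoD) simp
  then have "\<forall>\<^sub>F n in sequentially. \<forall>t. norm (f n t) \<le> w t"
    using eventually_tilt_ge eventually_ge_at_top[of 1]
  proof eventually_elim
    case (elim n)
    then have s: "tilt a n > 0" by (intro tilt_pos)
    have B: "B n > 0" "(B n)\<^sup>2 = var (tilt a n) n"
      using var_tilt_ge[of n] elim by (auto simp: B_def)
    show ?case
    proof
      fix t
      define z where "z = t / (2 * pi * B n)"
      show "norm (f n t) \<le> w t"
      proof (cases "z \<in> {-1/2..1/2}")
        case True
        then have "1 + z\<^sup>2 * (B n)\<^sup>2 \<le> C * exp (expo (tilt a n) n z)"
          unfolding B using C(2)[of "tilt a n" n z] elim s by auto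
        also have "z\<^sup>2 * (B n)\<^sup>2 = (t / (2 * pi))\<^sup>2"
          using B(1) by (simp add: z_def power_divide power_mult_distrib)
        finally have "(2 * pi)\<^sup>2 * (1 + (t / (2 * pi))\<^sup>2) \<le> (2 * pi)\<^sup>2 * (C * exp (expo (tilt a n) n z))"
          by (rule mult_left_mono) simp
        moreover have "(2 * pi)\<^sup>2 * (1 + (t / (2 * pi))\<^sup>2) = (2 * pi)\<^sup>2 + t\<^sup>2"
          by (simp add: distrib_left power_divide)
        moreover have "1 \<le> (2 * pi)\<^sup>2"
          using pi_gt3 by (intro one_le_power) simp
        ultimately have "1 + t\<^sup>2 \<le> C * (2 * pi)\<^sup>2 * exp (expo (tilt a n) n z)"
          unfolding mult.left_commute[of _ C] mult.assoc by linarith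
        moreover have "1 + t\<^sup>2 > 0" by (intro add_pos_nonneg) auto
        ultimately have "exp (- expo (tilt a n) n z) \<le> w t"
          by (simp add: w_def exp_minus inverse_eq_divide pos_le_divide_eq pos_divide_le_eq)
        with True show ?thesis
          by (simp add: f_def norm_exp_phase del: norm_exp_eq_Re flip: z_def)
      next
        case False
        then show ?thesis using C by (simp add: f_def w_def flip: z_def)
      qed
    qed
  qed
  then obtain n0 where n0: "\<And>n t. n \<ge> n0 \<Longrightarrow> norm (f n t) \<le> w t"
    by (auto simp: eventually_sequentially)
  \<comment> \<open>The majorant holds only from \<open>n0\<close> on, while the convergence theorem
    asks for it at every index; hence the shifted sequence.\<close>
  have "(\<lambda>i. integral\<^sup>L lborel (f (i + n0))) \<longlonglongrightarrow> integral\<^sup>L lborel (\<lambda>t. complex_of_real (exp (- (t\<^sup>2 / 2))))"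
  proof (rule integral_dominated_convergence[where w = w])
    show "f (i + n0) \<in> borel_measurable lborel" for i
      unfolding f_def phase_def by measurable
    show "integrable lborel w"
      using integrable_inverse_1_plus_square unfolding w_def
      by (intro integrable_mult_right) (simp add: set_integrable_def einterval_def)
    show "AE t in lborel. norm (f (i + n0) t) \<le> w t" for i
      using n0 by auto
    show "AE t in lborel. (\<lambda>i. f (i + n0) t) \<longlonglongrightarrow> complex_of_real (exp (- (t\<^sup>2 / 2)))"
    proof (rule AE_I2, rule LIMSEQ_ignore_initial_segment)
      fix t :: real
      \<comment> \<open>For fixed \<open>t\<close> the indicator is eventually 1, since its window
        \<open>\<bar>t\<bar> \<le> pi * B n\<close> grows at least like
        \<open>sqrt n\<close>.\<close>
      have "filterlim (\<lambda>n. sqrt (real n)) at_top sequentially" by real_asymp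
      then have "\<forall>\<^sub>F n in sequentially. \<bar>t\<bar> / pi < sqrt (real n)"
        by (simp add: filterlim_at_top_dense)
      then have "\<forall>\<^sub>F n in sequentially. exp (phase n (t / (2 * pi * B n))) = f n t"
        using eventually_ge_at_top[of 1]
      proof eventually_elim
        case (elim n)
        then have "\<bar>t\<bar> / pi < B n" using B_ge[of n] by simp
        moreover have "0 \<le> \<bar>t\<bar> / pi" by simp
        ultimately have B: "B n > 0" "\<bar>t\<bar> < pi * B n"
          by (linarith, simp add: field_simps)
        then have "\<bar>t / (2 * pi * B n)\<bar> \<le> 1 / 2"
          by (simp add: abs_mult field_simps)
        then have "t / (2 * pi * B n) \<in> {-1/2..1/2}"
            unfolding abs_le_iff atLeastAtMost_iff by linarith
        then show ?case by (simp add: f_def)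
      qed
      moreover have "(\<lambda>n. exp (phase n (t / (2 * pi * B n)))) \<longlonglongrightarrow> exp (complex_of_real (- (t\<^sup>2 / 2)))"
        using phase_tendsto[of t] unfolding B_def by (rule tendsto_exp)
      ultimately have "(\<lambda>n. f n t) \<longlonglongrightarrow> exp (complex_of_real (- (t\<^sup>2 / 2)))"
        by (rule Lim_transform_eventually[rotated])
      then show "(\<lambda>n. f n t) \<longlonglongrightarrow> complex_of_real (exp (- (t\<^sup>2 / 2)))"
        by (simp only: exp_of_real)
    qed
  qed auto
  then have "(\<lambda>n. integral\<^sup>L lborel (f n)) \<longlonglongrightarrow> integral\<^sup>L lborel (\<lambda>t. complex_of_real (exp (- (t\<^sup>2 / 2))))"
    by (rule LIMSEQ_offset)
  also have "integral\<^sup>L lborel (\<lambda>t. complex_of_real (exp (- (t\<^sup>2 / 2)))) =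
      complex_of_real (\<integral>t. sqrt (2 * pi) * std_normal_density t \<partial>lborel)"
    unfolding integral_complex_of_real[symmetric] by (simp add: std_normal_density_def)
  also have "(\<integral>t. sqrt (2 * pi) * std_normal_density t \<partial>lborel) = sqrt (2 * pi)"
    using integral_std_normal_moment_even[of 0] by simp
  finally show ?thesis by (simp add: f_def[abs_def] B_def)
qed

end

section \<open>From the Gaussian limit to the point probabilities\<close>

theorem theorem1:
  fixes p :: real
    and a :: "nat \<Rightarrow> real"
    and M :: "nat \<Rightarrow> 'a measure"
    and X :: "nat \<Rightarrow> nat \<Rightarrow> 'a \<Rightarrow> nat"
    and Y :: "nat \<Rightarrow> 'a \<Rightarrow> nat"
  assumes "p > 0"
    and "\<And>j. j \<ge> 1 \<Longrightarrow> a j > 0"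
    and "(\<lambda>n. a n / a (n + 1)) \<longlonglongrightarrow> 1"
    and "\<exists>\<gamma>1>0. \<exists>\<gamma>2>0. \<forall>\<^sub>F j in sequentially.
           \<gamma>1 * real j powr (p - 1) \<le> a j \<and> a j \<le> \<gamma>2 * real j powr (p - 1)"
    and "\<And>n. n \<ge> 1 \<Longrightarrow> prob_space (M n)"
    and "\<And>n. n \<ge> 1 \<Longrightarrow> prob_space.indep_vars (M n) (\<lambda>_. count_space UNIV) (X n) {1..n}"
    and "\<And>n l k. n \<ge> 1 \<Longrightarrow> l \<in> {1..n} \<Longrightarrow>
           \<P>(\<omega> in M n. X n l \<omega> = l * k) =
             a l ^ k * exp (- (tilt a n * real l * real k)) /
             (fact k * exp (a l * exp (- (tilt a n * real l))))"
    and "\<And>n \<omega>. n \<ge> 1 \<Longrightarrow> Y n \<omega> = (\<Sum>l=1..n. X n l \<omega>)"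
  shows "(\<forall>n\<ge>1. ((\<lambda>\<alpha>. char_fn (M n) (Y n) \<alpha> *
              exp (- (2 * complex_of_real pi * \<i> * complex_of_real \<alpha> * of_nat n)))
            has_integral complex_of_real \<P>(\<omega> in M n. Y n \<omega> = n)) {0..1}) \<and>
         asymp_equiv (\<lambda>n. \<P>(\<omega> in M n. Y n \<omega> = n)) sequentially
           (\<lambda>n. 1 / sqrt (2 * pi * Bsq a n))"
proof -
  obtain c1 c2 where c: "c1 > 0" "c2 > 0"
    "\<And>j. j \<ge> 1 \<Longrightarrow> c1 * real j powr (p - 1) \<le> a j"
    "\<And>j. j \<ge> 1 \<Longrightarrow> a j \<le> c2 * real j powr (p - 1)"
    using global_powr_bounds[OF assms(2,4)] by blast
  interpret W: powr_weights a p c1 c2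
    by unfold_locales (use assms(1) c in auto)
  define B where "B n = sqrt (W.var (tilt a n) n)" for n
  have Bsq: "Bsq a n = W.var (tilt a n) n" for n
    by (simp add: Bsq_def W.var_def)
  have rv: "X n l \<in> measurable (M n) (count_space UNIV)" if "n \<ge> 1" "l \<in> {1..n}" for n l
    using assms(6)[OF that(1), unfolded prob_space.indep_vars_def[OF assms(5)[OF that(1)]]] that(2)
    by blast
  have Y_eq: "Y n = (\<lambda>\<omega>. \<Sum>l=1..n. X n l \<omega>)" if "n \<ge> 1" for n
    using assms(8)[OF that] by auto
  have Y_rv: "Y n \<in> measurable (M n) (count_space UNIV)" if "n \<ge> 1" for n
    unfolding Y_eq[OF that] by (rule measurable_sum_nat) (rule rv[OF that])
  note inv = prob_space.char_fn_inversion[OF assms(5) Y_rv]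
  have cf: "char_fn (M n) (Y n) \<alpha> * exp (- (2 * complex_of_real pi * \<i> * complex_of_real \<alpha> * of_nat n)) =
      exp (W.phase n \<alpha>)" if n: "n \<ge> 1" for n \<alpha>
  proof -
    interpret prob_space "M n" by (rule assms(5)[OF n])
    let ?b = "\<lambda>l. complex_of_real (a l * exp (- (real l * tilt a n)))"
    let ?e = "\<lambda>l. exp (2 * complex_of_real pi * \<i> * complex_of_real \<alpha> * of_nat l)"
    have "char_fn (M n) (X n l) \<alpha> = exp (?b l * (?e l - 1))" if l: "l \<in> {1..n}" for l
    proof (rule char_fn_scaled_poisson[OF rv[OF n l]])
      show "0 < a l * exp (- (real l * tilt a n))" "l \<ge> 1" using assms(2)[of l] l by auto
      show "\<P>(\<omega> in M n. X n l \<omega> = l * k) =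
          (a l * exp (- (real l * tilt a n))) ^ k / fact k * exp (- (a l * exp (- (real l * tilt a n))))" for k
      proof -
        have "exp (- (real l * tilt a n)) ^ k = exp (- (tilt a n * real l * real k))"
          by (simp add: ac_simps flip: exp_of_nat_mult)
        then show ?thesis
          unfolding assms(7)[OF n l]
          by (simp add: power_mult_distrib exp_minus[of "a l * _"] divide_inverse mult.commute[of "real l"])
      qed
    qed
    then have "char_fn (M n) (Y n) \<alpha> = exp (\<Sum>l=1..n. ?b l * (?e l - 1))"
      using char_fn_sum[OF assms(6)[OF n] assms(8)[OF n], of \<alpha>] by (simp add: exp_sum)
    \<comment> \<open>The defining equation of the tilt distributes the centring term over the
      summands, so that it can be merged into \<open>phase\<close>.\<close>
    moreover have "2 * complex_of_real pi * \<i> * complex_of_real \<alpha> * of_nat n =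
        (\<Sum>l=1..n. ?b l * (2 * complex_of_real pi * \<i> * complex_of_real \<alpha> * of_nat l))"
    proof -
      have "of_nat n = complex_of_real (\<Sum>l=1..n. real l * a l * exp (- (real l * tilt a n)))"
        using W.tilt_eq[OF n] by simp
      then show ?thesis by (simp add: sum_distrib_left ac_simps)
    qed
    ultimately have "char_fn (M n) (Y n) \<alpha> * exp (- (2 * complex_of_real pi * \<i> * complex_of_real \<alpha> * of_nat n)) =
       exp ((\<Sum>l=1..n. ?b l * (?e l - 1)) -
         (\<Sum>l=1..n. ?b l * (2 * complex_of_real pi * \<i> * complex_of_real \<alpha> * of_nat l)))"
      by (simp add: exp_diff exp_minus divide_inverse)
    also have "(\<Sum>l=1..n. ?b l * (?e l - 1)) -
         (\<Sum>l=1..n. ?b l * (2 * complex_of_real pi * \<i> * complex_of_real \<alpha> * of_nat l)) = W.phase n \<alpha>"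
      unfolding W.phase_def sum_subtractf[symmetric]
      by (intro sum.cong refl) (simp add: algebra_simps)
    finally show ?thesis .
  qed
  have "((\<lambda>\<alpha>. char_fn (M n) (Y n) \<alpha> * exp (- (2 * complex_of_real pi * \<i> * complex_of_real \<alpha> * of_nat n)))
      has_integral complex_of_real \<P>(\<omega> in M n. Y n \<omega> = n)) {0..1}" if n: "n \<ge> 1" for n
  proof -
    have "((\<lambda>\<alpha>. indicator {0..1} \<alpha> *\<^sub>R (char_fn (M n) (Y n) \<alpha> *
        exp (- (2 * complex_of_real pi * \<i> * complex_of_real \<alpha> * of_nat n))))
        has_integral complex_of_real \<P>(\<omega> in M n. Y n \<omega> = n)) UNIV"
      using inv[OF n n, of 0 n] has_integral_integral_lborel by (fastforce simp: has_bochner_integral_iff)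
    then show ?thesis
      unfolding has_integral_restrict_UNIV[symmetric, where s = "{0..1}"]
      by (rule has_integral_eq[rotated]) auto
  qed
  moreover have "(\<lambda>n. \<P>(\<omega> in M n. Y n \<omega> = n)) \<sim>[sequentially] (\<lambda>n. 1 / sqrt (2 * pi * Bsq a n))"
  proof -
    have scaled: "complex_of_real (2 * pi * B n * \<P>(\<omega> in M n. Y n \<omega> = n)) =
        (\<integral>t. indicator {-1/2..1/2} (t / (2 * pi * B n)) *\<^sub>R exp (W.phase n (t / (2 * pi * B n))) \<partial>lborel)"
      if n: "n \<ge> 1" for n
    proof -
      have B: "B n > 0" using W.var_tilt_ge[OF n] n by (simp add: B_def)
      \<comment> \<open>The period starting at \<open>-1/2\<close> is chosen so that all frequencies
        satisfy \<open>\<bar>\<alpha>\<bar> \<le> 1 / 2\<close>, as \<open>expo_decay\<close>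
        demands; then \<open>\<alpha> = t / (2 * pi * B n)\<close> is substituted.\<close>
      have "complex_of_real \<P>(\<omega> in M n. Y n \<omega> = n) =
          (\<integral>\<alpha>. indicator {-1/2..1/2} \<alpha> *\<^sub>R exp (W.phase n \<alpha>) \<partial>lborel)"
        using has_bochner_integral_integral_eq[OF inv[OF n n, of "-1/2" n]] by (simp add: cf[OF n])
      also have "\<dots> = \<bar>1 / (2 * pi * B n)\<bar> *\<^sub>R (\<integral>t. indicator {-1/2..1/2} (0 + 1 / (2 * pi * B n) * t) *\<^sub>R
          exp (W.phase n (0 + 1 / (2 * pi * B n) * t)) \<partial>lborel)"
        using B by (intro lborel_integral_real_affine) auto
      finally show ?thesis using B by (simp add: scaleR_conv_of_real)
    qed
    have "(\<lambda>n. complex_of_real (2 * pi * B n * \<P>(\<omega> in M n. Y n \<omega> = n))) \<longlonglongrightarrow> complex_of_real (sqrt (2 * pi))"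
      by (rule Lim_transform_eventually[OF W.gaussian_limit[folded B_def]])
        (rule eventually_mono[OF eventually_ge_at_top[of 1]], rule scaled[symmetric])
    then have "(\<lambda>n. 2 * pi * B n * \<P>(\<omega> in M n. Y n \<omega> = n)) \<longlonglongrightarrow> sqrt (2 * pi)"
      by (simp only: tendsto_of_real_iff)
    from tendsto_divide[OF this tendsto_const[of "sqrt (2 * pi)"]]
    have lim: "(\<lambda>n. 2 * pi * B n * \<P>(\<omega> in M n. Y n \<omega> = n) / sqrt (2 * pi)) \<longlonglongrightarrow> 1"
      by simp
    \<comment> \<open>Since \<open>2 * pi / sqrt (2 * pi) = sqrt (2 * pi)\<close>, the normalised
      limit is literally the quotient in the asymptotic equivalence.\<close>
    have "2 * pi * x / sqrt (2 * pi) = sqrt (2 * pi) * x" for x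
      using real_sqrt_mult_self[of "2 * pi"] by (simp add: field_simps del: real_sqrt_mult_self)
    then have eq: "2 * pi * B n * P / sqrt (2 * pi) = P / (1 / sqrt (2 * pi * Bsq a n))" for P n
      by (simp add: B_def Bsq real_sqrt_mult mult.assoc)
    show ?thesis
      by (rule asymp_equivI') (use lim in \<open>simp only: eq\<close>)
  qed
  ultimately show ?thesis by blast
qed

end
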